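(* Let $n\geq 3$. For every set $P$ of $n$ points in strictly convex position in the plane, the union of $k$ maximal convex thrackles on $P$ has at most $kn-\binom{k}{2}$ edges; that is, if $T_1,\dots,T_k$ are $k$ maximal convex thrackles on $P$, then $$\left|E(T_1)\cup\dots\cup E(T_k)\right|\leq kn-\binom{k}{2}.$$
   Context: Points are in strictly convex position if every point is a vertex of the convex hull of the set and no three points are collinear. A geometric graph on $P$ has vertex set $P$ and its edges are closed line segments with two distinct endpoints in $P$. A convex thrackle on $P$ is a geometric graph with vertex set $P$ such that every pair of edges intersect, that is, they have a common endpoint or they cross. A convex thrackle on $P$ is maximal if it is edge-maximal, i.e. no further segment with endpoints in $P$ can be added so that the result is still a convex thrackle.
   Formalization: The formal theorem adds the hypothesis k ≤ n + 1/2 + √(2n + 1/4); without it the claim is false, e.g. for n = 5 and k = 9 maximal convex thrackles, including extensions of the five stars, the union has 10 edges but the bound is 9. *)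

theory Defs
  imports "HOL-Analysis.Analysis"
begin

definition strictly_convex_position :: "(real^2) set \<Rightarrow> bool" where
  "strictly_convex_position P \<longleftrightarrow>
     (\<forall>p\<in>P. p extreme_point_of (convex hull P)) \<and>
     (\<forall>a\<in>P. \<forall>b\<in>P. \<forall>c\<in>P. a \<noteq> b \<and> b \<noteq> c \<and> a \<noteq> c \<longrightarrow> \<not> collinear {a, b, c})"

definition segments_on :: "(real^2) set \<Rightarrow> (real^2) set set" where
  "segments_on P = {closed_segment a b | a b. a \<in> P \<and> b \<in> P \<and> a \<noteq> b}"

(* A geometric graph on P always has vertex set P, so it is represented by its edge set;
   an edge is the segment itself, as a set of points of the plane. *)
definition geometric_graph :: "(real^2) set \<Rightarrow> (real^2) set set \<Rightarrow> bool" where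
  "geometric_graph P E \<longleftrightarrow> E \<subseteq> segments_on P"

definition convex_thrackle :: "(real^2) set \<Rightarrow> (real^2) set set \<Rightarrow> bool" where
  "convex_thrackle P E \<longleftrightarrow> geometric_graph P E \<and> (\<forall>e\<in>E. \<forall>f\<in>E. e \<inter> f \<noteq> {})"

definition maximal_convex_thrackle :: "(real^2) set \<Rightarrow> (real^2) set set \<Rightarrow> bool" where
  "maximal_convex_thrackle P E \<longleftrightarrow>
     convex_thrackle P E \<and>
     (\<forall>e \<in> segments_on P. e \<notin> E \<longrightarrow> \<not> convex_thrackle P (insert e E))"

(* On points in strictly convex position, two edges intersect exactly when they have a
   common endpoint or cross (meet in a point interior to both). *)
lemma segments_intersect_iff:
  assumes "strictly_convex_position P"
    and "a \<in> P" "b \<in> P" "c \<in> P" "d \<in> P"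
  shows "closed_segment a b \<inter> closed_segment c d \<noteq> {} \<longleftrightarrow>
         {a, b} \<inter> {c, d} \<noteq> {} \<or> open_segment a b \<inter> open_segment c d \<noteq> {}"
    (is "?L \<longleftrightarrow> ?R")
proof
  assume ?R
  then show ?L
  proof
    assume "{a, b} \<inter> {c, d} \<noteq> {}"
    then obtain x where "x \<in> {a, b}" "x \<in> {c, d}" by blast
    then have "x \<in> closed_segment a b" "x \<in> closed_segment c d" by auto
    then show ?L by blast
  next
    assume "open_segment a b \<inter> open_segment c d \<noteq> {}"
    then show ?L using segment_open_subset_closed by blast
  qed
next
  have hull: "x \<in> convex hull P" if "x \<in> P" for x
    using that by (simp add: hull_inc)
  have ext: "x \<notin> open_segment u v" if "x \<in> P" "u \<in> P" "v \<in> P" for x u v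
  proof -
    have "x extreme_point_of (convex hull P)"
      using that(1) assms(1) by (simp add: strictly_convex_position_def)
    then show ?thesis
      using hull[OF that(2)] hull[OF that(3)] by (simp add: extreme_point_of_def)
  qed
  assume ?L
  then obtain x where x: "x \<in> closed_segment a b" "x \<in> closed_segment c d" by blast
  have "x \<in> open_segment a b \<or> x = a \<or> x = b" "x \<in> open_segment c d \<or> x = c \<or> x = d"
    using x unfolding open_segment_def by blast+
  then consider "x = a \<or> x = b" | "x = c \<or> x = d"
    | "x \<in> open_segment a b" "x \<in> open_segment c d" by argo
  then show ?R
  proof cases
    case 1
    then have "x \<notin> open_segment c d" using ext assms(2-5) by metis
    then show ?thesis using 1 \<open>x \<in> open_segment c d \<or> x = c \<or> x = d\<close> by auto
  next
    case 2
    then have "x \<notin> open_segment a b" using ext assms(2-5) by metis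
    then show ?thesis using 2 \<open>x \<in> open_segment a b \<or> x = a \<or> x = b\<close> by auto
  next
    case 3
    then show ?thesis by auto
  qed
qed

end

theory Submission
  imports Defs
begin

text \<open>
  The number \<open>k * n - (k choose 2)\<close> is the dimension of the variety of symmetric \<open>n \<times> n\<close> matrices of
  rank at most \<open>k\<close>. In dual form: if \<open>k \<le> n\<close> and the union \<open>U\<close> had more edges, then for any \<open>k\<close>
  vectors \<open>a\<close> in suitably general position there would be a nonzero symmetric matrix \<open>C\<close> with zero
  diagonal, supported on \<open>U\<close>, with \<open>C a = 0\<close> for all of them. There are positive weights \<open>K i j\<close> and,
  for each thrackle \<open>T\<close>, a vector \<open>a\<close> such that \<open>a i * a j * K i j\<close> is arbitrarily close to the indicator
  function of \<open>T\<close> (the thrackles are cells of the regular triangulation of the second hypersimplex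
  with heights \<open>- dist i j\<close>). Take such vectors for the given thrackles and let \<open>T\<close> contain an edge at
  which \<open>\<bar>C i j / K i j\<bar>\<close> is maximal. Then \<open>C a = 0\<close> says that the vertex sums of \<open>C / K\<close> over the
  edges of \<open>T\<close> almost vanish. Since a line never has edges of \<open>T\<close> on both of its sides, these vertex sums
  determine every entry of \<open>C / K\<close> on \<open>T\<close>, so that the maximum is almost zero as well, a contradiction.
  For \<open>k > n\<close> the bound is at least \<open>n choose 2\<close>.
\<close>

section \<open>Cutting the point set along a line\<close>

text \<open>Stated through segments instead of a line: this is how both the intersecting edges of a
  thrackle and the uncrossing of weights use a cut.\<close>

definition separated :: "'a::real_vector set \<Rightarrow> 'a set \<Rightarrow> bool" where
  "separated A B \<longleftrightarrow>
     (\<forall>a\<in>A. \<forall>b\<in>A. \<forall>c\<in>B. \<forall>d\<in>B. closed_segment a b \<inter> closed_segment c d = {})"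

definition general_position :: "(real^2) set \<Rightarrow> bool" where
  "general_position P \<longleftrightarrow>
     (\<forall>a\<in>P. \<forall>b\<in>P. \<forall>c\<in>P. a \<noteq> b \<and> b \<noteq> c \<and> a \<noteq> c \<longrightarrow> \<not> collinear {a, b, c})"

text \<open>Twice the signed area of the triangle \<open>a b x\<close>; its sign tells the side of
  the line through \<open>a\<close> and \<open>b\<close>.\<close>

definition orient :: "real^2 \<Rightarrow> real^2 \<Rightarrow> real^2 \<Rightarrow> real" where
  "orient a b x = (b - a)$1 * (x - a)$2 - (b - a)$2 * (x - a)$1"

lemma orient_affine:
  "orient a b ((1 - s) *\<^sub>R u + s *\<^sub>R v) = (1 - s) * orient a b u + s * orient a b v"
  by (simp add: orient_def algebra_simps)

lemma orient_self [simp]: "orient a b a = 0" "orient a b b = 0"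
  by (simp_all add: orient_def algebra_simps)

lemma orient_swap: "orient b a x = - orient a b x"
  by (simp add: orient_def algebra_simps)

lemma cross_zero_imp_parallel:
  fixes u v :: "real^2"
  assumes "u$1 * v$2 = u$2 * v$1" "u \<noteq> 0"
  shows "\<exists>c. v = c *\<^sub>R u"
proof -
  have "u$1 \<noteq> 0 \<or> u$2 \<noteq> 0"
    using assms(2) by (simp add: vec_eq_iff forall_2)
  then show ?thesis
  proof
    assume "u$1 \<noteq> 0"
    then have "v = (v$1 / u$1) *\<^sub>R u"
      using assms(1) by (simp add: vec_eq_iff forall_2 field_simps)
    then show ?thesis by blast
  next
    assume "u$2 \<noteq> 0"
    then have "v = (v$2 / u$2) *\<^sub>R u"
      using assms(1) by (simp add: vec_eq_iff forall_2 field_simps)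
    then show ?thesis by blast
  qed
qed

lemma orient_zero_collinear:
  assumes "orient a b x = 0" "a \<noteq> b"
  shows "collinear {a, b, x}"
proof -
  have "\<exists>c. x - a = c *\<^sub>R (b - a)"
    using cross_zero_imp_parallel[of "b - a" "x - a"] assms by (simp add: orient_def)
  then have "collinear {0, b - a, x - a}"
    unfolding collinear_lemma by blast
  then have "collinear {b, a, x}"
    by (subst collinear_3) simp_all
  then show ?thesis by (simp add: insert_commute)
qed

text \<open>An open half-plane together with one point of its boundary line is convex.\<close>

lemma orient_segment_pos:
  assumes "z \<in> closed_segment u v" "orient a b p = 0"
    and "u = p \<or> 0 < orient a b u" "v = p \<or> 0 < orient a b v"
  shows "z = p \<or> 0 < orient a b z"
proof -
  obtain s where s: "0 \<le> s" "s \<le> 1" "z = (1 - s) *\<^sub>R u + s *\<^sub>R v"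
    using assms(1) by (auto simp: closed_segment_def)
  have z: "orient a b z = (1 - s) * orient a b u + s * orient a b v"
    using s(3) by (simp add: orient_affine)
  consider "s = 0 \<or> s = 1" | "u = p" "v = p" | "0 < s" "s < 1" "u \<noteq> p \<or> v \<noteq> p"
    using s by linarith
  then show ?thesis
  proof cases
    case 1
    then show ?thesis using s(3) assms by auto
  next
    case 2
    then show ?thesis using s(3) by (simp add: algebra_simps)
  next
    case 3
    then show ?thesis using assms(2-4) z by (auto intro: add_pos_pos)
  qed
qed

lemma separated_sym: "separated A B \<Longrightarrow> separated B A"
  unfolding separated_def by blast

text \<open>By \<open>orient_segment_pos\<close> the segments of each side stay in an open
  half-plane plus one boundary point. The boundary points differ, so these two convex sets are
  disjoint.\<close>

lemma separated_line_points:
  assumes "\<forall>x\<in>A. 0 < orient a b x" "\<forall>x\<in>B. orient a b x < 0" "p \<noteq> q"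
    and "orient a b p = 0" "orient a b q = 0"
  shows "separated (insert p A) (insert q B)"
  unfolding separated_def
proof (intro ballI, rule ccontr)
  fix u v c d
  assume u: "u \<in> insert p A" "v \<in> insert p A" and c: "c \<in> insert q B" "d \<in> insert q B"
    and "closed_segment u v \<inter> closed_segment c d \<noteq> {}"
  then obtain z where z: "z \<in> closed_segment u v" "z \<in> closed_segment c d" by blast
  have 1: "z = p \<or> 0 < orient a b z"
    using orient_segment_pos[OF z(1)] u assms(1,4) by blast
  have "z = q \<or> 0 < orient b a z"
    using orient_segment_pos[OF z(2), of b a q] c assms(2,5) orient_swap[of b a] by auto
  then show False using 1 assms(3-5) by (auto simp: orient_swap[of b a])
qed

lemma separated_line_side:
  assumes "\<forall>x\<in>A. 0 < orient a b x" "\<forall>x\<in>B. orient a b x < 0"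
  shows "separated (insert a (insert b A)) B"
  unfolding separated_def
proof (intro ballI, rule ccontr)
  fix u v c d
  assume u: "u \<in> insert a (insert b A)" "v \<in> insert a (insert b A)" and c: "c \<in> B" "d \<in> B"
    and "closed_segment u v \<inter> closed_segment c d \<noteq> {}"
  then obtain z where z: "z \<in> closed_segment u v" "z \<in> closed_segment c d" by blast
  have "0 \<le> orient a b u" "0 \<le> orient a b v"
    using u assms(1) by (auto simp: less_imp_le)
  then have 1: "0 \<le> orient a b z"
    using z(1) by (auto simp: closed_segment_def orient_affine)
  obtain s where s: "0 \<le> s" "s \<le> 1" "z = (1 - s) *\<^sub>R c + s *\<^sub>R d"
    using z(2) by (auto simp: closed_segment_def)
  have "(1 - s) * orient a b c + s * orient a b d < 0"
    using assms(2) c s(1,2) by (intro convex_bound_lt) auto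
  then show False using 1 s(3) by (simp add: orient_affine)
qed

text \<open>General position leaves only \<open>a\<close> and \<open>b\<close> on the line, and each
  of them may go to either side independently; this gives four cuts.\<close>

lemma cut_along_line:
  assumes "general_position P" "a \<in> P" "b \<in> P" "a \<noteq> b"
  obtains A B where "P = insert a (insert b (A \<union> B))" "A \<inter> B = {}" "a \<notin> A \<union> B" "b \<notin> A \<union> B"
    "separated A (insert a (insert b B))" "separated (insert a A) (insert b B)"
    "separated (insert b A) (insert a B)" "separated (insert a (insert b A)) B"
proof -
  define A where "A = {x \<in> P. 0 < orient a b x}"
  define B where "B = {x \<in> P. orient a b x < 0}"
  have "orient a b x \<noteq> 0" if "x \<in> P" "x \<noteq> a" "x \<noteq> b" for x
  proof -
    have "\<not> collinear {a, b, x}"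
      using assms that unfolding general_position_def by metis
    then show ?thesis using orient_zero_collinear assms(4) by blast
  qed
  then have P: "P = insert a (insert b (A \<union> B))"
    using assms(2,3) by (auto simp: A_def B_def not_less_iff_gr_or_eq)
  have A: "\<forall>x\<in>A. 0 < orient a b x" "\<forall>x\<in>B. orient a b x < 0"
    by (auto simp: A_def B_def)
  then have B: "\<forall>x\<in>B. 0 < orient b a x" "\<forall>x\<in>A. orient b a x < 0"
    by (simp_all add: orient_swap[of b a])
  show ?thesis
  proof (rule that[OF P])
    show "A \<inter> B = {}" "a \<notin> A \<union> B" "b \<notin> A \<union> B" using A by force+
    show "separated (insert a A) (insert b B)" "separated (insert b A) (insert a B)"
      using separated_line_points A assms(4) by simp_all
    show "separated (insert a (insert b A)) B"
      using separated_line_side[OF A] .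
    show "separated A (insert a (insert b B))"
      using separated_sym[OF separated_line_side[OF B]] by (simp add: insert_commute)
  qed
qed

section \<open>Recovering a symmetric matrix from its cuts\<close>

text \<open>Ordered pairs are summed, so for symmetric \<open>c\<close> each edge inside
  \<open>A\<close> counts twice.\<close>

definition pair_mass :: "('a \<Rightarrow> 'a \<Rightarrow> real) \<Rightarrow> 'a set \<Rightarrow> real" where
  "pair_mass c A = (\<Sum>i\<in>A. \<Sum>j\<in>A. c i j)"

lemma pair_mass_insert:
  assumes "finite A" "a \<notin> A" "\<And>i j. c i j = c j i" "c a a = 0"
  shows "pair_mass c (insert a A) = pair_mass c A + 2 * (\<Sum>j\<in>A. c a j)"
proof -
  have "(\<Sum>i\<in>A. c i a) = (\<Sum>i\<in>A. c a i)" using assms(3) by metis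
  then show ?thesis using assms by (simp add: pair_mass_def sum.distrib)
qed

text \<open>The entries between \<open>A\<close> and \<open>B\<close> occur in both vertex sums and
  cancel. Thus vertex sums control a cut as soon as the mass of one side is known.\<close>

lemma pair_mass_diff:
  assumes "finite A" "finite B" "A \<inter> B = {}" "\<And>i j. c i j = c j i"
  shows "pair_mass c A - pair_mass c B =
    (\<Sum>i\<in>A. \<Sum>j\<in>A \<union> B. c i j) - (\<Sum>i\<in>B. \<Sum>j\<in>A \<union> B. c i j)"
proof -
  have "(\<Sum>i\<in>A. \<Sum>j\<in>B. c i j) = (\<Sum>i\<in>B. \<Sum>j\<in>A. c i j)"
    by (subst sum.swap) (intro sum.cong refl assms(4))
  then show ?thesis
    using assms(1-3) by (simp add: pair_mass_def sum.union_disjoint sum.distrib)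
qed

text \<open>Inclusion-exclusion over the four ways of splitting \<open>P\<close> along the line through \<open>a\<close> and \<open>b\<close>.\<close>
lemma entry_le_of_cuts:
  assumes "general_position P" "finite P" "a \<in> P" "b \<in> P" "a \<noteq> b"
    and sym: "\<And>i j. c i j = c j i" and diag: "\<And>i. c i i = 0"
    and cut: "\<And>A B. P = A \<union> B \<Longrightarrow> A \<inter> B = {} \<Longrightarrow> separated A B \<Longrightarrow> \<bar>pair_mass c A\<bar> \<le> \<rho>"
  shows "\<bar>c a b\<bar> \<le> 2 * \<rho>"
proof -
  obtain A B where AB: "P = insert a (insert b (A \<union> B))" "A \<inter> B = {}" "a \<notin> A \<union> B" "b \<notin> A \<union> B"
    and sep: "separated A (insert a (insert b B))" "separated (insert a A) (insert b B)"
    "separated (insert b A) (insert a B)" "separated (insert a (insert b A)) B"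
    using cut_along_line[OF assms(1,3-5)] by metis
  have fin: "finite A" using AB(1) assms(2) by simp
  have 1: "\<bar>pair_mass c A\<bar> \<le> \<rho>" using AB assms(5) by (intro cut[OF _ _ sep(1)]) auto
  have 2: "\<bar>pair_mass c (insert a A)\<bar> \<le> \<rho>" using AB assms(5) by (intro cut[OF _ _ sep(2)]) auto
  have 3: "\<bar>pair_mass c (insert b A)\<bar> \<le> \<rho>" using AB assms(5) by (intro cut[OF _ _ sep(3)]) auto
  have 4: "\<bar>pair_mass c (insert a (insert b A))\<bar> \<le> \<rho>"
    using AB assms(5) by (intro cut[OF _ _ sep(4)]) auto
  have "pair_mass c (insert a (insert b A)) - pair_mass c (insert a A) - pair_mass c (insert b A)
      + pair_mass c A = 2 * c a b"
    using AB fin assms(5) by (simp add: pair_mass_insert[OF _ _ sym diag])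
  then show ?thesis using 1 2 3 4 by linarith
qed

section \<open>Exchanging disjoint segments increases length\<close>

text \<open>Radon's theorem splits the four points into two parts with intersecting hulls.
  Extremality rules out one point against three, and disjointness rules out the given pairing; the
  other two pairings remain.\<close>

lemma disjoint_segments_uncross:
  fixes P :: "(real^2) set"
  assumes P: "strictly_convex_position P" and "a \<in> P" "b \<in> P" "c \<in> P" "d \<in> P"
    and ne: "a \<noteq> b" "c \<noteq> d"
    and disj: "closed_segment a b \<inter> closed_segment c d = {}"
  shows "closed_segment a c \<inter> closed_segment b d \<noteq> {} \<or> closed_segment a d \<inter> closed_segment b c \<noteq> {}"
proof -
  have dist: "a \<noteq> c" "a \<noteq> d" "b \<noteq> c" "b \<noteq> d" using disj by auto
  let ?S = "{a, b, c, d}"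
  have "card ?S = 4" using dist ne by simp
  then have "affine_dependent ?S" by (intro affine_dependent_biggerset) auto
  then obtain M Q where MQ: "M \<inter> Q = {}" "M \<union> Q = ?S" "convex hull M \<inter> convex hull Q \<noteq> {}"
    using Radon_partition[of ?S] by auto
  \<comment> \<open>Removing an extreme point from the hull of \<open>P\<close> leaves a convex set,
    which still contains the hull of \<open>X\<close>.\<close>
  have ext: "x \<notin> convex hull X" if "x \<in> P" "X \<subseteq> P" "x \<notin> X" for x X
  proof -
    have "x extreme_point_of (convex hull P)"
      using P that(1) by (simp add: strictly_convex_position_def)
    then have "convex (convex hull P - {x})"
      using extreme_point_of_stillconvex convex_convex_hull by blast
    moreover have "X \<subseteq> convex hull P - {x}"
      using that hull_subset[of P convex] by auto
    ultimately have "convex hull X \<subseteq> convex hull P - {x}" by (simp add: hull_minimal)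
    then show ?thesis by blast
  qed
  have S: "?S \<subseteq> P" using assms by auto
  have Q: "Q = ?S - M" using MQ by blast
  have single: False if "M = {x} \<or> Q = {x}" for x
  proof -
    have "x \<in> P" "x \<notin> M \<or> x \<notin> Q" "M \<subseteq> P" "Q \<subseteq> P" using that MQ S by auto
    then show False using ext[of x M] ext[of x Q] that MQ(1,3) by auto
  qed
  have "M \<in> Pow ?S" using MQ by blast
  moreover have "M \<noteq> {}" "Q \<noteq> {}" using MQ(3) by auto
  moreover have "\<forall>x. M \<noteq> {x} \<and> Q \<noteq> {x}" using single by blast
  ultimately have "M = {a, b} \<and> Q = {c, d} \<or> M = {c, d} \<and> Q = {a, b} \<or> M = {a, c} \<and> Q = {b, d}
      \<or> M = {b, d} \<and> Q = {a, c} \<or> M = {a, d} \<and> Q = {b, c} \<or> M = {b, c} \<and> Q = {a, d}"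
    using dist ne unfolding Q Pow_insert by (auto simp: insert_Diff_if)
  then show ?thesis using MQ(3) disj by (auto simp: segment_convex_hull Int_commute)
qed

text \<open>Two triangle inequalities through the crossing point \<open>x\<close>; equality in both
  would put \<open>x\<close> on the two disjoint segments.\<close>

lemma crossing_sum_dist_less:
  fixes a b c d :: "'a::euclidean_space"
  assumes "closed_segment a c \<inter> closed_segment b d \<noteq> {}"
    and "closed_segment a b \<inter> closed_segment c d = {}"
  shows "dist a b + dist c d < dist a c + dist b d"
proof -
  obtain x where x: "x \<in> closed_segment a c" "x \<in> closed_segment b d" using assms(1) by blast
  have e: "dist a c = dist a x + dist x c" "dist b d = dist b x + dist x d"
    using x by (simp_all add: between between_mem_segment [symmetric])
  have t: "dist a b \<le> dist a x + dist x b" "dist c d \<le> dist c x + dist x d"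
    by (rule dist_triangle)+
  have "dist a b \<noteq> dist a x + dist x b \<or> dist c d \<noteq> dist c x + dist x d"
    using assms(2) by (auto simp: between between_mem_segment [symmetric])
  then show ?thesis using e t by (smt (verit) dist_commute)
qed

section \<open>Symmetric matrix scaling\<close>

lemma compact_box_fun:
  fixes S :: "'a \<Rightarrow> real set"
  assumes "\<And>i. compact (S i)"
  shows "compact (PiE UNIV S)"
  using assms by (simp add: compactin_PiE flip: compactin_euclidean_iff euclidean_product_topology)

text \<open>Provides coercivity. For nonnegative \<open>u\<close>, the tangent of
  \<open>\<kappa> * exp u\<close> where its slope is \<open>2 * m\<close> keeps slope
  \<open>m\<close> after subtracting \<open>m * u\<close>; for negative \<open>u\<close> the linear
  term alone suffices.\<close>

lemma exp_minus_linear_ge: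
  fixes \<kappa> m :: real
  assumes "0 < \<kappa>" "0 < m"
  shows "m * \<bar>u\<bar> - 2 * m * \<bar>ln (2 * m / \<kappa>)\<bar> \<le> \<kappa> * exp u - m * u"
proof (cases "0 \<le> u")
  case True
  define L where "L = ln (2 * m / \<kappa>)"
  have "exp u = exp (u - L) * (2 * m / \<kappa>)"
    using assms by (simp add: L_def exp_diff)
  then have "\<kappa> * exp u = 2 * m * exp (u - L)"
    using assms by (simp add: field_simps)
  moreover have "2 * m * (1 + (u - L)) \<le> 2 * m * exp (u - L)"
    using assms by (intro mult_left_mono exp_ge_add_one_self) auto
  ultimately have "2 * m + 2 * m * u - 2 * m * L \<le> \<kappa> * exp u"
    by (simp add: algebra_simps)
  moreover have "2 * m * L \<le> 2 * m * \<bar>L\<bar>" using assms by (intro mult_left_mono) auto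
  moreover have "m * \<bar>u\<bar> = m * u" using True by simp
  ultimately show ?thesis
    using assms unfolding L_def[symmetric] by linarith
next
  case False
  have "0 \<le> \<kappa> * exp u" "0 \<le> 2 * m * \<bar>ln (2 * m / \<kappa>)\<bar>" using assms by simp_all
  then show ?thesis using False by (simp add: abs_if)
qed

text \<open>The scaling factors are \<open>exp (\<alpha> i)\<close> for a minimizer \<open>\<alpha>\<close> of the sum of
  \<open>K i j * exp (\<alpha> i + \<alpha> j) - \<mu> i j * (\<alpha> i + \<alpha> j)\<close>; at least three indices are needed for this sum to
  be coercive in \<open>\<alpha>\<close>.\<close>
lemma symmetric_scaling_exists:
  fixes K \<mu> :: "'a \<Rightarrow> 'a \<Rightarrow> real"
  assumes fin: "finite P" and card: "3 \<le> card P" and "0 < \<eta>"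
    and K: "\<And>i j. K i j = K j i" "\<And>i. K i i = 0" "\<And>i j. i \<noteq> j \<Longrightarrow> 0 < K i j"
    and \<mu>: "\<And>i j. \<mu> i j = \<mu> j i" "\<And>i. \<mu> i i = 0" "\<And>i j. i \<noteq> j \<Longrightarrow> \<eta> \<le> \<mu> i j"
  shows "\<exists>a. (\<forall>i. 0 < a i) \<and> (\<forall>i\<in>P. (\<Sum>j\<in>P. a i * a j * K i j) = (\<Sum>j\<in>P. \<mu> i j))"
proof -
  define g where "g i j u = K i j * exp u - \<mu> i j * u" for i j and u :: real
  define c where "c i j = 2 * \<mu> i j * \<bar>ln (2 * \<mu> i j / K i j)\<bar>" for i j
  define F where "F \<alpha> = (\<Sum>i\<in>P. \<Sum>j\<in>P. g i j (\<alpha> i + \<alpha> j))" for \<alpha> :: "'a \<Rightarrow> real"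
  define C where "C = (\<Sum>i\<in>P. \<Sum>j\<in>P. c i j)"
  define B where "B = 2 * ((F (\<lambda>_. 0) + C) / \<eta>)"
  have \<mu>0: "0 < \<mu> i j" if "i \<noteq> j" for i j using \<mu>(3)[OF that] \<open>0 < \<eta>\<close> by linarith
  have g: "\<eta> * \<bar>u\<bar> \<le> g i j u + c i j" if "i \<noteq> j" for i j u
  proof -
    have "\<eta> * \<bar>u\<bar> \<le> \<mu> i j * \<bar>u\<bar>" using \<mu>(3)[OF that] by (intro mult_right_mono) auto
    then show ?thesis
      using exp_minus_linear_ge[OF K(3)[OF that] \<mu>0[OF that], of u] by (simp add: g_def c_def)
  qed
  have gc: "0 \<le> g i j u + c i j" for i j u
  proof (cases "i = j")
    case False
    have "0 \<le> \<eta> * \<bar>u\<bar>" using \<open>0 < \<eta>\<close> by simp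
    then show ?thesis using g[OF False, of u] by linarith
  qed (simp add: g_def c_def K \<mu>)
  have pair: "\<bar>\<alpha> p + \<alpha> q\<bar> \<le> B / 2" if "F \<alpha> \<le> F (\<lambda>_. 0)" "p \<in> P" "q \<in> P" "p \<noteq> q" for \<alpha> p q
  proof -
    have "\<eta> * \<bar>\<alpha> p + \<alpha> q\<bar> \<le> g p q (\<alpha> p + \<alpha> q) + c p q" by (rule g[OF that(4)])
    also have "\<dots> \<le> (\<Sum>j\<in>P. g p j (\<alpha> p + \<alpha> j) + c p j)"
      using that fin gc by (intro member_le_sum) auto
    also have "\<dots> \<le> (\<Sum>i\<in>P. \<Sum>j\<in>P. g i j (\<alpha> i + \<alpha> j) + c i j)"
      using that fin gc by (intro member_le_sum[where f = "\<lambda>i. \<Sum>j\<in>P. g i j (\<alpha> i + \<alpha> j) + c i j"] sum_nonneg) auto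
    also have "\<dots> = F \<alpha> + C" by (simp add: F_def C_def sum.distrib)
    also have "\<dots> \<le> F (\<lambda>_. 0) + C" using that by simp
    finally show ?thesis using \<open>0 < \<eta>\<close> by (simp add: B_def field_simps)
  qed
  have box: "\<bar>\<alpha> p\<bar> \<le> B" if F: "F \<alpha> \<le> F (\<lambda>_. 0)" and "p \<in> P" for \<alpha> p
  proof -
    \<comment> \<open>Three pair sums determine one value: \<open>2 * \<alpha> p = (\<alpha> p +
      \<alpha> q) + (\<alpha> p + \<alpha> r) - (\<alpha> q + \<alpha> r)\<close>.\<close>
    have "2 \<le> card (P - {p})" using card fin that by simp
    then obtain D where "D \<subseteq> P - {p}" "card D = 2" by (meson obtain_subset_with_card_n)
    then obtain q r where qr: "q \<in> P" "r \<in> P" "q \<noteq> r" "p \<noteq> q" "p \<noteq> r"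
      by (auto simp: card_2_iff)
    show ?thesis
      using pair[OF F, of p q] pair[OF F, of p r] pair[OF F, of q r] qr that(2) by linarith
  qed
  \<comment> \<open>Coordinates outside \<open>P\<close> are frozen at 0 to make the domain compact.
    Every function that vanishes off \<open>P\<close> and is no worse than 0 lies in
    \<open>X\<close>, so a minimum on \<open>X\<close> is global among functions vanishing off
    \<open>P\<close>.\<close>
  define X where "X = PiE UNIV (\<lambda>i. if i \<in> P then {-B..B} else {0::real})"
  have "compact X" unfolding X_def by (intro compact_box_fun) auto
  moreover have zero: "(\<lambda>_. 0) \<in> X"
    using box[of "\<lambda>_. 0"] by (auto simp: X_def PiE_iff)
  moreover have "continuous_on X F"
    unfolding F_def g_def
    by (intro continuous_intros continuous_on_subset[OF continuous_on_product_coordinates]) auto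
  ultimately obtain \<alpha> where \<alpha>: "\<alpha> \<in> X" "\<forall>\<beta>\<in>X. F \<alpha> \<le> F \<beta>"
    using continuous_attains_inf[of X F] by blast
  have min: "F \<alpha> \<le> F \<beta>" if "\<And>i. i \<notin> P \<Longrightarrow> \<beta> i = 0" for \<beta>
  proof (cases "F \<beta> \<le> F (\<lambda>_. 0)")
    case True
    then have "\<beta> \<in> X" using box[OF True] that by (force simp: X_def PiE_iff abs_le_iff)
    then show ?thesis using \<alpha> by blast
  next
    case False
    then show ?thesis using \<alpha>(2) zero by force
  qed
  have stat: "(\<Sum>j\<in>P. K i j * exp (\<alpha> i + \<alpha> j)) = (\<Sum>j\<in>P. \<mu> i j)" if i: "i \<in> P" for i
  proof -
    \<comment> \<open>Vary \<alpha> along the unit vector at \<open>i\<close>; by symmetry the row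
      and the column of \<open>i\<close> contribute equally to the derivative.\<close>
    define d where "d p = (if p = i then 1 else 0 :: real)" for p
    define h where "h p q = K p q * exp (\<alpha> p + \<alpha> q) - \<mu> p q" for p q
    have "((\<lambda>s. F (\<lambda>p. \<alpha> p + s * d p)) has_real_derivative
        (\<Sum>p\<in>P. \<Sum>q\<in>P. h p q * (d p + d q))) (at 0)"
      unfolding F_def g_def h_def
      by (rule derivative_eq_intros refl | simp add: algebra_simps)+
    moreover have "F (\<lambda>p. \<alpha> p + 0 * d p) \<le> F (\<lambda>p. \<alpha> p + s * d p)" for s
    proof -
      have "\<alpha> p + s * d p = 0" if "p \<notin> P" for p
      proof -
        have "\<alpha> p \<in> (if p \<in> P then {-B..B} else {0})" using \<alpha>(1) unfolding X_def by (rule PiE_mem) simp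
        then show ?thesis using i that by (auto simp: d_def)
      qed
      then show ?thesis using min[of "\<lambda>p. \<alpha> p + s * d p"] by simp
    qed
    ultimately have "(\<Sum>p\<in>P. \<Sum>q\<in>P. h p q * (d p + d q)) = 0"
      by (intro DERIV_local_min[of _ _ 0 1]) auto
    moreover have "(\<Sum>p\<in>P. \<Sum>q\<in>P. h p q * (d p + d q))
        = (\<Sum>p\<in>P. \<Sum>q\<in>P. h p q * d p) + (\<Sum>p\<in>P. \<Sum>q\<in>P. h p q * d q)"
      by (simp add: distrib_left sum.distrib)
    moreover have "(\<Sum>p\<in>P. \<Sum>q\<in>P. h p q * d p) = (\<Sum>q\<in>P. h i q)"
      
      unfolding sum_distrib_right[symmetric] d_def
      using i fin by (simp add: if_distrib[of "(*) _"] cong: if_cong)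
    moreover have "(\<Sum>p\<in>P. \<Sum>q\<in>P. h p q * d q) = (\<Sum>q\<in>P. h q i)"
      using i fin by (simp add: d_def if_distrib[of "(*) _"] cong: if_cong)
    moreover have "h q i = h i q" for q
      unfolding h_def using K(1)[of q i] \<mu>(1)[of q i] by (simp add: add.commute)
    ultimately have "(\<Sum>q\<in>P. h i q) = 0" by simp
    then show ?thesis by (simp add: h_def sum_subtractf)
  qed
  have "(\<Sum>j\<in>P. exp (\<alpha> i) * exp (\<alpha> j) * K i j) = (\<Sum>j\<in>P. \<mu> i j)" if "i \<in> P" for i
    using stat[OF that] by (simp add: exp_add mult_ac)
  then show ?thesis by (intro exI[of _ "\<lambda>i. exp (\<alpha> i)"]) simp
qed

section \<open>Approximating a thrackle by scaling an exponential of distances\<close>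

text \<open>The adjacency matrix of \<open>T\<close>.\<close>

definition incidence :: "(real^2) set set \<Rightarrow> real^2 \<Rightarrow> real^2 \<Rightarrow> real" where
  "incidence T i j = (if i \<noteq> j \<and> closed_segment i j \<in> T then 1 else 0)"

lemma incidence_sym: "incidence T i j = incidence T j i"
  by (auto simp: incidence_def closed_segment_commute)

text \<open>Edges on both sides of the cut would be disjoint edges of \<open>T\<close>. The weight
  \<open>c\<close> is free so that the lemma serves both the scaling target and the dual
  matrix.\<close>

lemma incidence_mass_separated:
  assumes "convex_thrackle P T" "separated A B"
  shows "pair_mass (\<lambda>i j. incidence T i j * c i j) A = 0 \<or> pair_mass (\<lambda>i j. incidence T i j * c i j) B = 0"
proof (cases "\<exists>a\<in>A. \<exists>b\<in>A. closed_segment a b \<in> T")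
  case True
  then have "closed_segment c d \<notin> T" if "c \<in> B" "d \<in> B" for c d
    using assms that unfolding convex_thrackle_def separated_def by meson
  then show ?thesis by (simp add: pair_mass_def incidence_def)
next
  case False
  then show ?thesis by (auto simp: pair_mass_def incidence_def)
qed

text \<open>There are finitely many quadruples, so the strict gain from uncrossing is
  uniform.\<close>

lemma uncrossing_gain:
  assumes "finite P" "strictly_convex_position P"
  shows "\<exists>\<gamma>>0. \<forall>a\<in>P. \<forall>b\<in>P. \<forall>c\<in>P. \<forall>d\<in>P. a \<noteq> b \<and> c \<noteq> d \<and>
    closed_segment a b \<inter> closed_segment c d = {} \<longrightarrow>
    dist a b + dist c d + \<gamma> \<le> dist a c + dist b d \<or> dist a b + dist c d + \<gamma> \<le> dist a d + dist b c"
proof -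
  define Q where "Q = {(a, b, c, d). a \<in> P \<and> b \<in> P \<and> c \<in> P \<and> d \<in> P \<and> a \<noteq> b \<and> c \<noteq> d \<and>
    closed_segment a b \<inter> closed_segment c d = {}}"
  define f where "f = (\<lambda>(a :: real^2, b, c, d). max (dist a c + dist b d) (dist a d + dist b c)
    - (dist a b + dist c d) :: real)"
  \<comment> \<open>The inserted 1 keeps the minimum defined if there are no disjoint pairs.\<close>
  define \<gamma> where "\<gamma> = Min (insert 1 (f ` Q))"
  have "Q \<subseteq> P \<times> P \<times> P \<times> P" by (auto simp: Q_def)
  then have "finite Q" using assms(1) by (simp add: finite_subset)
  then have fin: "finite (insert 1 (f ` Q))" by simp
  have pos: "0 < f q" if q: "q \<in> Q" for q
  proof -
    obtain a b c d where abcd: "q = (a, b, c, d)" "a \<in> P" "b \<in> P" "c \<in> P" "d \<in> P" "a \<noteq> b" "c \<noteq> d"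
      "closed_segment a b \<inter> closed_segment c d = {}" using q by (auto simp: Q_def)
    have "dist a b + dist c d < dist a c + dist b d \<or> dist a b + dist c d < dist a d + dist b c"
      using disjoint_segments_uncross[OF assms(2) abcd(2-8)] crossing_sum_dist_less[of a c b d]
        crossing_sum_dist_less[of a d b c] abcd(8)
      by (metis closed_segment_commute dist_commute)
    then show ?thesis by (auto simp: f_def abcd(1))
  qed
  have "0 < \<gamma>" using pos fin by (auto simp: \<gamma>_def)
  moreover have "\<gamma> \<le> f q" if "q \<in> Q" for q using fin that by (simp add: \<gamma>_def)
  then have "\<gamma> \<le> f (a, b, c, d)" if "a \<in> P" "b \<in> P" "c \<in> P" "d \<in> P" "a \<noteq> b" "c \<noteq> d"
    "closed_segment a b \<inter> closed_segment c d = {}" for a b c d using that by (simp add: Q_def)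
  then have "dist a b + dist c d + \<gamma> \<le> dist a c + dist b d \<or> dist a b + dist c d + \<gamma> \<le> dist a d + dist b c"
    if "a \<in> P" "b \<in> P" "c \<in> P" "d \<in> P" "a \<noteq> b" "c \<noteq> d"
    "closed_segment a b \<inter> closed_segment c d = {}" for a b c d
    using that unfolding f_def by (smt (verit) case_prod_conv)
  ultimately show ?thesis by blast
qed

lemma pair_mass_le:
  fixes M :: real
  assumes "finite P" "A \<subseteq> P" "\<And>i j. i \<in> A \<Longrightarrow> j \<in> A \<Longrightarrow> c i j \<le> M" "0 \<le> M"
  shows "pair_mass c A \<le> (card P)\<^sup>2 * M"
proof -
  have "pair_mass c A \<le> (\<Sum>i\<in>A. \<Sum>j\<in>A. M)"
    unfolding pair_mass_def using assms(3) by (intro sum_mono)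
  also have "\<dots> = (card A)\<^sup>2 * M" by (simp add: power2_eq_square)
  also have "\<dots> \<le> (card P)\<^sup>2 * M"
    using assms by (intro mult_right_mono) (auto intro: power_mono card_mono)
  finally show ?thesis .
qed

lemma pair_mass_prod_le:
  fixes M :: real
  assumes "finite P" "A \<subseteq> P" "B \<subseteq> P" "0 \<le> M"
    and "\<And>a b c d. a \<in> A \<Longrightarrow> b \<in> A \<Longrightarrow> c \<in> B \<Longrightarrow> d \<in> B \<Longrightarrow> w a b * w c d \<le> M"
  shows "pair_mass w A * pair_mass w B \<le> (card P)^4 * M"
proof -
  have "pair_mass w A * pair_mass w B = (\<Sum>a\<in>A. \<Sum>b\<in>A. \<Sum>c\<in>B. \<Sum>d\<in>B. w a b * w c d)"
    unfolding pair_mass_def sum_distrib_right by (simp only: sum_distrib_left)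
  also have "\<dots> \<le> (\<Sum>a\<in>A. \<Sum>b\<in>A. \<Sum>c\<in>B. \<Sum>d\<in>B. M)"
    using assms(5) by (intro sum_mono)
  also have "\<dots> = (card A)\<^sup>2 * ((card B)\<^sup>2 * M)" by (simp add: power2_eq_square)
  also have "\<dots> \<le> (card P)\<^sup>2 * ((card P)\<^sup>2 * M)"
    using assms by (intro mult_mono mult_right_mono mult_nonneg_nonneg) (auto intro: power_mono card_mono)
  finally show ?thesis by (simp add: power2_eq_square power4_eq_xxxx mult_ac)
qed

text \<open>With \<open>K\<close> the exponential of a large multiple of the distance, the entries \<open>w i j = a i * a j * K i j\<close>
  for two disjoint segments have a small product, since uncrossing them increases the total length.
  So across a separating line one side carries almost no weight \<open>w\<close>, and the same holds
  for a thrackle. As the vertex sums agree, all cuts nearly agree, and hence so do all entries.\<close>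
lemma thrackle_scaling:
  assumes P: "strictly_convex_position P" and fin: "finite P" and card: "3 \<le> card P"
    and "0 < \<epsilon>"
  shows "\<exists>K. (\<forall>i j. K i j = K j i) \<and> (\<forall>i. K i i = 0) \<and> (\<forall>i j. i \<noteq> j \<longrightarrow> 0 < K i j) \<and>
    (\<forall>T. convex_thrackle P T \<longrightarrow> (\<exists>a. \<forall>i\<in>P. \<forall>j\<in>P. \<bar>a i * a j * K i j - incidence T i j\<bar> < \<epsilon>))"
proof -
  obtain \<gamma> where \<gamma>: "0 < \<gamma>" and gain: "\<And>a b c d. a \<in> P \<Longrightarrow> b \<in> P \<Longrightarrow> c \<in> P \<Longrightarrow> d \<in> P \<Longrightarrow>
    a \<noteq> b \<Longrightarrow> c \<noteq> d \<Longrightarrow> closed_segment a b \<inter> closed_segment c d = {} \<Longrightarrow>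
    dist a b + dist c d + \<gamma> \<le> dist a c + dist b d \<or> dist a b + dist c d + \<gamma> \<le> dist a d + dist b c"
    using uncrossing_gain[OF fin P] by blast
  define n where "n = real (card P)"
  have n: "3 \<le> n" using card by (simp add: n_def)
  \<comment> \<open>Makes \<open>2 * \<rho> + \<eta> < \<epsilon>\<close>: the error from the cuts
    plus the constant added to the target.\<close>
  define \<eta> where "\<eta> = min 1 (\<epsilon> / (3 * (n\<^sup>2 + 1)))"
  have n2: "0 < 3 * (n\<^sup>2 + 1)" by (smt (verit) zero_le_power2)
  have \<eta>: "0 < \<eta>" "\<eta> \<le> 1" using \<open>0 < \<epsilon>\<close> n2 by (auto simp: \<eta>_def)
  define \<rho> where "\<rho> = n\<^sup>2 * \<eta>"
  have \<rho>: "0 < \<rho>" using n \<eta> by (simp add: \<rho>_def)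
  have "3 * (n\<^sup>2 + 1) * \<eta> \<le> 3 * (n\<^sup>2 + 1) * (\<epsilon> / (3 * (n\<^sup>2 + 1)))"
    using n2 by (intro mult_left_mono) (auto simp: \<eta>_def)
  also have "\<dots> = \<epsilon>" using n2 by simp
  finally have "3 * \<rho> + 3 * \<eta> \<le> \<epsilon>" by (simp add: \<rho>_def algebra_simps)
  then have \<epsilon>: "2 * \<rho> + \<eta> < \<epsilon>" using \<rho> \<eta> by linarith
  \<comment> \<open>Makes \<open>(2 * n)\<^sup>2 * M\<close> equal to
    \<open>\<rho>\<^sup>2 / n^4\<close>, so that the at most \<open>n^4\<close> products across a
    cut sum to at most \<open>\<rho>\<^sup>2\<close>.\<close>
  define M where "M = (\<rho>\<^sup>2 / n^4) / (2 * n)\<^sup>2"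
  have M: "0 < M" using \<rho> n by (simp add: M_def)
  \<comment> \<open>Large enough to turn the length gain \<gamma> into a factor of at most
    \<open>M\<close>.\<close>
  define \<tau> where "\<tau> = max 0 (- ln M / \<gamma>)"
  have \<tau>: "0 \<le> \<tau>" by (simp add: \<tau>_def)
  have "- ln M / \<gamma> \<le> \<tau>" by (simp add: \<tau>_def)
  then have "- (\<tau> * \<gamma>) \<le> ln M" using \<gamma> by (simp add: field_simps)
  then have expM: "exp (- (\<tau> * \<gamma>)) \<le> M" using M by (metis exp_le_cancel_iff exp_ln)
  define K :: "real^2 \<Rightarrow> real^2 \<Rightarrow> real" where "K i j = (if i = j then 0 else exp (\<tau> * dist i j))" for i j
  have K: "K i j = K j i" "K i i = 0" "i \<noteq> j \<Longrightarrow> 0 < K i j" for i j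
    by (simp_all add: K_def dist_commute)
  have "\<exists>a. \<forall>i\<in>P. \<forall>j\<in>P. \<bar>a i * a j * K i j - incidence T i j\<bar> < \<epsilon>"
    if T: "convex_thrackle P T" for T
  proof -
    \<comment> \<open>The constant \<eta> is added off the diagonal because the scaling lemma asks
      for targets bounded away from 0.\<close>
    define \<mu> where "\<mu> i j = (if i = j then 0 else incidence T i j + \<eta>)" for i j
    have \<mu>: "\<mu> i j = \<mu> j i" "\<mu> i i = 0" "i \<noteq> j \<Longrightarrow> \<eta> \<le> \<mu> i j" for i j
      using incidence_sym[of T i j] by (simp add: \<mu>_def) (simp_all add: \<mu>_def incidence_def)
    obtain a where a: "\<And>i. 0 < a i"
      and sums: "\<And>i. i \<in> P \<Longrightarrow> (\<Sum>j\<in>P. a i * a j * K i j) = (\<Sum>j\<in>P. \<mu> i j)"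
      using symmetric_scaling_exists[of P \<eta> K \<mu>, OF fin card \<eta>(1) K(1,2,3) \<mu>(1,2,3)] by blast
    define w where "w i j = a i * a j * K i j" for i j
    have w: "w i j = w j i" "w i i = 0" "0 \<le> w i j" for i j
      using K(1)[of i j] K(2) K(3)[of i j] a[of i] a[of j]
      by (cases "i = j"; simp add: w_def mult_ac)+
    have w_le: "w i j \<le> 2 * n" if "i \<in> P" "j \<in> P" for i j
    proof -
      have "w i j \<le> (\<Sum>j\<in>P. w i j)" using that w fin by (intro member_le_sum) auto
      also have "\<dots> = (\<Sum>j\<in>P. \<mu> i j)" using sums[OF that(1)] by (simp add: w_def)
      also have "\<dots> \<le> (\<Sum>j\<in>P. 2)" using \<eta> by (intro sum_mono) (auto simp: \<mu>_def incidence_def)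
      finally show ?thesis by (simp add: n_def)
    qed
    \<comment> \<open>Uncrossing keeps the four endpoints, so the factors \<open>a\<close> are the
      same on both sides and only the lengths matter.\<close>
    have uncross: "w p q * w r s \<le> (2 * n)\<^sup>2 * M"
      if "p \<in> P" "q \<in> P" "r \<in> P" "s \<in> P" "p \<noteq> q" "r \<noteq> s" "p \<noteq> r" "q \<noteq> s"
        and "dist p q + dist r s + \<gamma> \<le> dist p r + dist q s" for p q r s
    proof -
      have "\<tau> * (dist p q + dist r s + \<gamma>) \<le> \<tau> * (dist p r + dist q s)"
        using that(9) \<tau> by (intro mult_left_mono)
      then have "\<tau> * dist p q + \<tau> * dist r s \<le> - (\<tau> * \<gamma>) + (\<tau> * dist p r + \<tau> * dist q s)"
        by (simp add: algebra_simps)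
      then have "exp (\<tau> * dist p q + \<tau> * dist r s) \<le> exp (- (\<tau> * \<gamma>) + (\<tau> * dist p r + \<tau> * dist q s))"
        by simp
      then have "K p q * K r s \<le> exp (- (\<tau> * \<gamma>)) * (K p r * K q s)"
        using that(5-8) unfolding exp_add by (simp add: K_def)
      then have "(a p * a q * a r * a s) * (K p q * K r s)
          \<le> (a p * a q * a r * a s) * (exp (- (\<tau> * \<gamma>)) * (K p r * K q s))"
        using a by (intro mult_left_mono) (simp_all add: less_imp_le)
      then have "w p q * w r s \<le> exp (- (\<tau> * \<gamma>)) * (w p r * w q s)"
        by (simp add: w_def mult_ac)
      also have "\<dots> \<le> M * ((2 * n) * (2 * n))"
        using expM M n w w_le[of p r] w_le[of q s] that by (intro mult_mono) auto
      finally show ?thesis by (simp add: power2_eq_square mult_ac)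
    qed
    have disj: "w p q * w r s \<le> (2 * n)\<^sup>2 * M"
      if "p \<in> P" "q \<in> P" "r \<in> P" "s \<in> P" "closed_segment p q \<inter> closed_segment r s = {}" for p q r s
    proof (cases "p = q \<or> r = s")
      case True
      then have "w p q * w r s = 0" using w(2) by auto
      moreover have "0 \<le> (2 * n)\<^sup>2 * M" using M by simp
      ultimately show ?thesis by linarith
    next
      case False
      then have ne: "p \<noteq> q" "r \<noteq> s" "p \<noteq> r" "p \<noteq> s" "q \<noteq> r" "q \<noteq> s" using that(5) by auto
      have "dist p q + dist r s + \<gamma> \<le> dist p r + dist q s \<or> dist p q + dist s r + \<gamma> \<le> dist p s + dist q r"
        using gain[OF that(1-4) ne(1,2) that(5)] by (metis dist_commute)
      then show ?thesis
        using uncross[of p q r s] uncross[of p q s r] that(1-4) ne w(1)[of s r] by auto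
    qed
    have cut: "\<bar>pair_mass (\<lambda>i j. w i j - \<mu> i j) A\<bar> \<le> \<rho>"
      if AB: "P = A \<union> B" "A \<inter> B = {}" "separated A B" for A B
    proof -
      have finAB: "finite A" "finite B" using fin AB(1) by auto
      have "pair_mass w A * pair_mass w B \<le> (card P)^4 * ((2 * n)\<^sup>2 * M)"
        using AB M unfolding separated_def
        by (intro pair_mass_prod_le[OF fin] disj) auto
      also have "\<dots> = \<rho>\<^sup>2" using n by (simp add: M_def n_def)
      finally have "pair_mass w A * pair_mass w B \<le> \<rho>\<^sup>2" .
      then have w_small: "pair_mass w A \<le> \<rho> \<or> pair_mass w B \<le> \<rho>"
        using \<rho> mult_strict_mono[of \<rho> "pair_mass w A" \<rho> "pair_mass w B"]
        by (force simp: power2_eq_square)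
      have \<mu>_le: "pair_mass \<mu> S \<le> \<rho>" if "S \<subseteq> P" "pair_mass (\<lambda>i j. incidence T i j * 1) S = 0" for S
      proof -
        have "pair_mass \<mu> S = pair_mass (incidence T) S + pair_mass (\<lambda>i j. if i = j then 0 else \<eta>) S"
          unfolding pair_mass_def sum.distrib[symmetric]
          by (intro sum.cong refl) (simp add: \<mu>_def incidence_def)
        also have "\<dots> \<le> \<rho>"
          using pair_mass_le[OF fin that(1), of "\<lambda>i j. if i = j then 0 else \<eta>" \<eta>] that(2) \<eta>
          by (simp add: \<rho>_def n_def)
        finally show ?thesis .
      qed
      have \<mu>_small: "pair_mass \<mu> A \<le> \<rho> \<or> pair_mass \<mu> B \<le> \<rho>"
        using incidence_mass_separated[OF T AB(3), of "\<lambda>_ _. 1"] \<mu>_le AB(1) by blast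
      have nonneg: "0 \<le> pair_mass w S" "0 \<le> pair_mass \<mu> S" for S
        unfolding pair_mass_def using w \<eta>(1) by (auto intro!: sum_nonneg simp: \<mu>_def incidence_def)
      \<comment> \<open>Equal vertex sums make the difference of the masses of \<open>w\<close> and
        \<mu> the same on \<open>A\<close> and \<open>B\<close>. The small side of \<open>w\<close>
        bounds it above, the small side of \<mu> bounds it below.\<close>
      have "pair_mass w A - pair_mass w B = pair_mass \<mu> A - pair_mass \<mu> B"
        using pair_mass_diff[OF finAB AB(2), of w] pair_mass_diff[OF finAB AB(2), of \<mu>] w \<mu> sums AB(1)
        by (simp add: w_def)
      moreover have "pair_mass (\<lambda>i j. w i j - \<mu> i j) A = pair_mass w A - pair_mass \<mu> A"
        by (simp add: pair_mass_def sum_subtractf)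
      ultimately show ?thesis
        using w_small \<mu>_small nonneg[of A] nonneg[of B] by linarith
    qed
    have "\<bar>w i j - incidence T i j\<bar> < \<epsilon>" if "i \<in> P" "j \<in> P" for i j
    proof (cases "i = j")
      case True
      then show ?thesis using w \<open>0 < \<epsilon>\<close> by (simp add: incidence_def)
    next
      case False
      have "general_position P"
        using P by (simp add: strictly_convex_position_def general_position_def)
      then have "\<bar>w i j - \<mu> i j\<bar> \<le> 2 * \<rho>"
        using that False fin w \<mu> cut by (intro entry_le_of_cuts[of P i j "\<lambda>i j. w i j - \<mu> i j"]) auto
      then show ?thesis using \<epsilon> \<eta> False by (simp add: \<mu>_def)
    qed
    then show ?thesis by (auto simp: w_def)
  qed
  then show ?thesis using K by blast
qed

section \<open>Linear systems and vectors in general position\<close>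

text \<open>Gaussian elimination, one equation and one pivot unknown at a time.\<close>

lemma underdetermined_system:
  fixes M :: "'q \<Rightarrow> 'v \<Rightarrow> real"
  assumes "finite Q" "finite V" "card Q < card V"
  shows "\<exists>x. (\<exists>v\<in>V. x v \<noteq> 0) \<and> (\<forall>q\<in>Q. (\<Sum>v\<in>V. M q v * x v) = 0)"
  using assms
proof (induction Q arbitrary: V M rule: finite_induct)
  case empty
  then have "V \<noteq> {}" by auto
  then show ?case by (intro exI[of _ "\<lambda>_. 1"]) auto
next
  case (insert q Q)
  show ?case
  proof (cases "\<exists>v\<in>V. M q v \<noteq> 0")
    case False
    have "card Q < card V" using insert by simp
    then obtain x where "\<exists>v\<in>V. x v \<noteq> 0" "\<forall>r\<in>Q. (\<Sum>v\<in>V. M r v * x v) = 0"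
      using insert.IH[of V M] insert.prems by blast
    then show ?thesis using False by (intro exI[of _ x]) simp
  next
    case True
    then obtain u where u: "u \<in> V" "M q u \<noteq> 0" by blast
    define W where "W = V - {u}"
    have W: "V = insert u W" "u \<notin> W" "finite W" using u insert.prems by (auto simp: W_def)
    have "card Q < card W" using insert.prems insert.hyps W by simp
    then obtain x where x: "\<exists>v\<in>W. x v \<noteq> 0"
      "\<forall>r\<in>Q. (\<Sum>v\<in>W. (M r v - M r u * M q v / M q u) * x v) = 0"
      using insert.IH[of W "\<lambda>r v. M r v - M r u * M q v / M q u"] W(3) by blast
    define S where "S r = (\<Sum>v\<in>W. M r v * x v)" for r
    \<comment> \<open>The value at the pivot \<open>u\<close> is chosen to solve equation
      \<open>q\<close>.\<close>
    define y where "y = x(u := - S q / M q u)"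
    have y: "(\<Sum>v\<in>V. M r v * y v) = S r - M r u * S q / M q u" for r
    proof -
      have "(\<Sum>v\<in>W. M r v * y v) = S r"
        unfolding S_def using W(2) by (intro sum.cong) (auto simp: y_def)
      then show ?thesis using W by (simp add: y_def)
    qed
    have "S r - M r u * S q / M q u = 0" if "r \<in> Q" for r
    proof -
      have "(\<Sum>v\<in>W. (M r v - M r u * M q v / M q u) * x v) = S r - M r u / M q u * S q"
        unfolding S_def sum_distrib_left sum_subtractf[symmetric]
        by (intro sum.cong) (simp_all add: algebra_simps)
      then show ?thesis using x(2) that by simp
    qed
    moreover have "\<exists>v\<in>V. y v \<noteq> 0" using x(1) W by (auto simp: y_def)
    ultimately show ?thesis using u(2) by (intro exI[of _ y]) (simp add: y)
  qed
qed

text \<open>At each step at most one multiple of the unit vector at \<open>p m\<close> is bad, so one of \<open>0\<close> and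
  \<open>\<delta> m\<close> is good. The conclusion says that the matrix with entries \<open>(p m, p m')\<close> for
  \<open>m, m' < l\<close> is nonsingular.\<close>
lemma nonsingular_perturbation:
  fixes a :: "nat \<Rightarrow> 'a \<Rightarrow> real"
  assumes "finite P" "inj_on p {..<k}" "p ` {..<k} \<subseteq> P" "\<And>l. l < k \<Longrightarrow> \<delta> l \<noteq> 0"
  shows "\<exists>s. (\<forall>l. s l = 0 \<or> s l = \<delta> l) \<and>
    (\<forall>l\<le>k. \<forall>b. (\<forall>m<l. (\<Sum>i\<in>P. (a m i + s m * of_bool (i = p m)) * b i) = 0) \<longrightarrow>
      (\<forall>i. i \<notin> p ` {..<l} \<longrightarrow> b i = 0) \<longrightarrow> (\<forall>i. b i = 0))"
  using assms(2-)
proof (induction k)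
  case 0
  show ?case by (intro exI[of _ "\<lambda>_. 0"]) simp
next
  case (Suc k)
  have "inj_on p {..<k}" "p ` {..<k} \<subseteq> P" "\<And>l. l < k \<Longrightarrow> \<delta> l \<noteq> 0"
    using Suc.prems by (auto intro: inj_on_subset)
  from Suc.IH[OF this] obtain s where s: "\<And>l. s l = 0 \<or> s l = \<delta> l"
    and nonsing: "\<And>l b. l \<le> k \<Longrightarrow> \<forall>m<l. (\<Sum>i\<in>P. (a m i + s m * of_bool (i = p m)) * b i) = 0 \<Longrightarrow>
      \<forall>i. i \<notin> p ` {..<l} \<longrightarrow> b i = 0 \<Longrightarrow> \<forall>i. b i = 0"
    by blast
  have pk: "p k \<in> P" using Suc.prems(2) by auto
  \<comment> \<open>Since the first \<open>k\<close> rows are nonsingular, these \<open>b\<close>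
    form a space of dimension at most one, parametrized by the coordinate at
    \<open>p k\<close>.\<close>
  define orth where "orth b \<longleftrightarrow> (\<forall>m<k. (\<Sum>i\<in>P. (a m i + s m * of_bool (i = p m)) * b i) = 0) \<and>
    (\<forall>i. i \<notin> p ` {..<Suc k} \<longrightarrow> b i = 0)" for b
  define r where "r b = (\<Sum>i\<in>P. a k i * b i)" for b
  have zero: "\<forall>i. b i = 0" if "orth b" "b (p k) = 0" for b
  proof (rule nonsing[of k])
    show "\<forall>i. i \<notin> p ` {..<k} \<longrightarrow> b i = 0"
      using that by (auto simp: orth_def lessThan_Suc)
  qed (use that in \<open>auto simp: orth_def\<close>)
  define good where "good t \<longleftrightarrow> (\<forall>b. orth b \<longrightarrow> r b + t * b (p k) = 0 \<longrightarrow> (\<forall>i. b i = 0))" for t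
  have "good 0 \<or> good (\<delta> k)"
  proof (rule ccontr)
    assume "\<not> (good 0 \<or> good (\<delta> k))"
    then obtain b c where b: "orth b" "r b = 0" "\<exists>i. b i \<noteq> 0"
      and c: "orth c" "r c + \<delta> k * c (p k) = 0" "\<exists>i. c i \<noteq> 0"
      unfolding good_def by auto
    have ne: "b (p k) \<noteq> 0" "c (p k) \<noteq> 0" using zero b c by blast+
    \<comment> \<open>This vanishes at \<open>p k\<close>, hence everywhere, so \<open>b\<close> and
      \<open>c\<close> are proportional; then \<open>r b = 0\<close> forces
      \<open>r c = 0\<close>.\<close>
    define d where "d i = c (p k) * b i - b (p k) * c i" for i
    have lin: "(\<Sum>i\<in>P. f i * d i) = c (p k) * (\<Sum>i\<in>P. f i * b i) - b (p k) * (\<Sum>i\<in>P. f i * c i)" for f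
      unfolding d_def sum_distrib_left sum_subtractf[symmetric]
      by (intro sum.cong) (simp_all add: algebra_simps)
    have "orth d" using b(1) c(1) unfolding orth_def lin by (simp add: d_def)
    moreover have "d (p k) = 0" by (simp add: d_def)
    ultimately have "\<forall>i. d i = 0" by (rule zero)
    then have "r d = 0" by (simp add: r_def)
    then have "b (p k) * r c = 0" using lin[of "a k"] b(2) by (simp add: r_def)
    then show False using ne c(2) Suc.prems(3)[of k] by simp
  qed
  then obtain t where t: "t = 0 \<or> t = \<delta> k" "good t" by blast
  let ?s = "s(k := t)"
  have "\<forall>i. b i = 0" if l: "l \<le> Suc k" and b: "\<forall>m<l. (\<Sum>i\<in>P. (a m i + ?s m * of_bool (i = p m)) * b i) = 0"
    "\<forall>i. i \<notin> p ` {..<l} \<longrightarrow> b i = 0" for l b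
  proof (cases "l = Suc k")
    case False
    then show ?thesis using nonsing[of l b] l b by simp
  next
    case True
    have "orth b" using b unfolding orth_def True by (auto simp: less_Suc_eq)
    moreover have "(\<Sum>i\<in>P. (a k i + t * of_bool (i = p k)) * b i) = r b + t * b (p k)"
    proof -
      have "(\<Sum>i\<in>P. (a k i + t * of_bool (i = p k)) * b i)
          = (\<Sum>i\<in>P. a k i * b i + (if i = p k then t * b i else 0))"
        by (intro sum.cong refl) (simp add: distrib_right)
      then show ?thesis using pk assms(1) by (simp add: r_def sum.distrib)
    qed
    then have "r b + t * b (p k) = 0" using b(1)[rule_format, of k] True by simp
    ultimately show ?thesis using t(2) by (simp add: good_def)
  qed
  then show ?case using s t(1) by (intro exI[of _ ?s]) auto
qed

text \<open>Continuity at 0. It preserves the approximation while the vectors are moved into general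
  position.\<close>

lemma small_perturbation:
  fixes a d :: "'a \<Rightarrow> real"
  assumes "finite P" "\<forall>i\<in>P. \<forall>j\<in>P. \<bar>a i * a j * K i j - c i j\<bar> < \<epsilon>"
  shows "\<exists>\<delta>>0. \<forall>i\<in>P. \<forall>j\<in>P. \<bar>(a i + \<delta> * d i) * (a j + \<delta> * d j) * K i j - c i j\<bar> < \<epsilon>"
proof -
  have "\<forall>\<^sub>F t in at_right 0. \<bar>(a i + t * d i) * (a j + t * d j) * K i j - c i j\<bar> < \<epsilon>"
    if "i \<in> P" "j \<in> P" for i j
  proof -
    have "((\<lambda>t. \<bar>(a i + t * d i) * (a j + t * d j) * K i j - c i j\<bar>) \<longlongrightarrow>
        \<bar>(a i + 0 * d i) * (a j + 0 * d j) * K i j - c i j\<bar>) (at_right 0)"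
      by (intro tendsto_intros)
    then show ?thesis using assms(2) that by (intro order_tendstoD(2)) auto
  qed
  then have "\<forall>\<^sub>F t in at_right 0. \<forall>i\<in>P. \<forall>j\<in>P. \<bar>(a i + t * d i) * (a j + t * d j) * K i j - c i j\<bar> < \<epsilon>"
    using assms(1) by (auto intro!: eventually_ball_finite)
  moreover have "\<forall>\<^sub>F t in at_right (0::real). 0 < t" by (rule eventually_at_right_less)
  ultimately have "\<forall>\<^sub>F t in at_right 0. 0 < t \<and>
      (\<forall>i\<in>P. \<forall>j\<in>P. \<bar>(a i + t * d i) * (a j + t * d j) * K i j - c i j\<bar> < \<epsilon>)"
    by eventually_elim simp
  then show ?thesis using eventually_happens[of _ "at_right (0::real)"] trivial_limit_at_right_real by blast
qed

section \<open>Vertex sums on a thrackle and the dual matrix\<close>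

text \<open>Quantitative injectivity of vertex sums on the edges of \<open>T\<close>: in every cut
  one side has mass zero, so \<open>pair_mass_diff\<close> bounds the other by the absolute vertex
  sums, and \<open>entry_le_of_cuts\<close> passes from cuts to entries.\<close>

lemma thrackle_entry_le:
  fixes c :: "real^2 \<Rightarrow> real^2 \<Rightarrow> real" and \<beta> :: real
  assumes P: "general_position P" "finite P" and T: "convex_thrackle P T"
    and c: "\<And>i j. c i j = c j i"
    and b: "\<And>i. i \<in> P \<Longrightarrow> \<bar>\<Sum>j\<in>P. incidence T i j * c i j\<bar> \<le> \<beta>"
    and pq: "p \<in> P" "q \<in> P" "p \<noteq> q" "closed_segment p q \<in> T"
  shows "\<bar>c p q\<bar> \<le> 2 * (card P * \<beta>)"
proof -
  let ?c = "\<lambda>i j. incidence T i j * c i j"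
  have sym: "?c i j = ?c j i" and diag: "?c i i = 0" for i j
    using c[of i j] incidence_sym[of T i j] by (simp_all add: incidence_def)
  have "\<bar>?c p q\<bar> \<le> 2 * (card P * \<beta>)"
  proof (rule entry_le_of_cuts[OF P pq(1-3), of ?c, OF sym diag])
    fix A B assume AB: "P = A \<union> B" "A \<inter> B = {}" "separated A B"
    have finAB: "finite A" "finite B" using P(2) AB(1) by auto
    have "\<bar>(\<Sum>i\<in>A. \<Sum>j\<in>P. ?c i j) - (\<Sum>i\<in>B. \<Sum>j\<in>P. ?c i j)\<bar>
        \<le> (\<Sum>i\<in>A. \<bar>\<Sum>j\<in>P. ?c i j\<bar>) + (\<Sum>i\<in>B. \<bar>\<Sum>j\<in>P. ?c i j\<bar>)"
      by (rule order_trans[OF abs_triangle_ineq4]) (intro add_mono sum_abs)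
    also have "\<dots> = (\<Sum>i\<in>P. \<bar>\<Sum>j\<in>P. ?c i j\<bar>)"
      using AB finAB by (simp add: sum.union_disjoint)
    also have "\<dots> \<le> (\<Sum>i\<in>P. \<beta>)" using b by (intro sum_mono)
    finally have le: "\<bar>(\<Sum>i\<in>A. \<Sum>j\<in>P. ?c i j) - (\<Sum>i\<in>B. \<Sum>j\<in>P. ?c i j)\<bar> \<le> card P * \<beta>" by simp
    have "pair_mass ?c A - pair_mass ?c B = (\<Sum>i\<in>A. \<Sum>j\<in>P. ?c i j) - (\<Sum>i\<in>B. \<Sum>j\<in>P. ?c i j)"
      unfolding AB(1) by (rule pair_mass_diff[OF finAB AB(2), of ?c, OF sym])
    then show "\<bar>pair_mass ?c A\<bar> \<le> card P * \<beta>"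
      using incidence_mass_separated[OF T AB(3), of c] le by auto
  qed
  then show ?thesis using pq by (simp add: incidence_def)
qed

text \<open>Symmetric matrices \<open>C\<close> with zero diagonal and \<open>C a = 0\<close> for all vectors \<open>a\<close> of a \<open>k\<close>-dimensional
  space satisfy only \<open>\<Sum>l<k. (n - l)\<close> independent linear conditions: once \<open>C\<close> kills the first
  \<open>l\<close> vectors, the image of the next one is orthogonal to them by symmetry, so \<open>l\<close> of its coordinates need
  not be prescribed.\<close>
lemma symmetric_kernel_exists:
  fixes A :: "nat \<Rightarrow> 'a::real_vector \<Rightarrow> real"
  assumes "finite P" "card P = n" "finite U" "(\<Sum>l<k. n - l) < card U"
    and p: "inj_on p {..<k}" "p ` {..<k} \<subseteq> P"
    and nonsing: "\<forall>l\<le>k. \<forall>b. (\<forall>m<l. (\<Sum>i\<in>P. A m i * b i) = 0) \<longrightarrow>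
      (\<forall>i. i \<notin> p ` {..<l} \<longrightarrow> b i = 0) \<longrightarrow> (\<forall>i. b i = 0)"
  shows "\<exists>x. (\<exists>e\<in>U. x e \<noteq> 0) \<and> (\<forall>l<k. \<forall>i\<in>P.
    (\<Sum>j\<in>P. (if i \<noteq> j \<and> closed_segment i j \<in> U then x (closed_segment i j) else 0) * A l j) = 0)"
proof -
  \<comment> \<open>The prescribed equations: for vector \<open>l\<close> the coordinates at the
    first \<open>l\<close> points are left out.\<close>
  define Q where "Q = (SIGMA l:{..<k}. P - p ` {..<l})"
  have "card Q = (\<Sum>l<k. card (P - p ` {..<l}))"
    unfolding Q_def using assms(1) by (simp add: card_SigmaI)
  also have "\<dots> = (\<Sum>l<k. n - l)"
  proof (intro sum.cong refl)
    fix l assume l: "l \<in> {..<k}"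
    then have "inj_on p {..<l}" "p ` {..<l} \<subseteq> P" using p by (auto intro: inj_on_subset)
    then show "card (P - p ` {..<l}) = n - l"
      using assms(1,2) by (simp add: card_Diff_subset card_image)
  qed
  finally have "card Q < card U" using assms(4) by simp
  moreover have "finite Q" unfolding Q_def using assms(1) by simp
  \<comment> \<open>The unknowns are indexed by edges; the inner sum selects the endpoint of
    \<open>e\<close> opposite to \<open>snd q\<close>.\<close>
  ultimately obtain x where x: "\<exists>e\<in>U. x e \<noteq> 0"
    and eqs: "\<forall>q\<in>Q. (\<Sum>e\<in>U. (\<Sum>j\<in>P. if snd q \<noteq> j \<and> closed_segment (snd q) j = e then A (fst q) j else 0) * x e) = 0"
    using underdetermined_system[of Q U "\<lambda>q e. \<Sum>j\<in>P. if snd q \<noteq> j \<and> closed_segment (snd q) j = e then A (fst q) j else 0"]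
      assms(3) by blast
  define C where "C i j = (if i \<noteq> j \<and> closed_segment i j \<in> U then x (closed_segment i j) else 0)" for i j
  have C_sym: "C i j = C j i" for i j by (auto simp: C_def closed_segment_commute)
  have eqC: "(\<Sum>j\<in>P. C i j * A l j) = 0" if "l < k" "i \<in> P - p ` {..<l}" for l i
  proof -
    have "(l, i) \<in> Q" using that by (simp add: Q_def)
    from bspec[OF eqs this]
    have "0 = (\<Sum>e\<in>U. (\<Sum>j\<in>P. if i \<noteq> j \<and> closed_segment i j = e then A l j else 0) * x e)"
      unfolding fst_conv snd_conv by (rule sym)
    also have "\<dots> = (\<Sum>j\<in>P. \<Sum>e\<in>U. (if i \<noteq> j \<and> closed_segment i j = e then A l j else 0) * x e)"
      unfolding sum_distrib_right by (rule sum.swap)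
    also have "\<dots> = (\<Sum>j\<in>P. C i j * A l j)"
    proof (intro sum.cong refl)
      fix j
      have "(\<Sum>e\<in>U. (if i \<noteq> j \<and> closed_segment i j = e then A l j else 0) * x e)
          = (\<Sum>e\<in>U. if closed_segment i j = e then (if i \<noteq> j then A l j * x e else 0) else 0)"
        by (intro sum.cong) auto
      then show "(\<Sum>e\<in>U. (if i \<noteq> j \<and> closed_segment i j = e then A l j else 0) * x e) = C i j * A l j"
        using assms(3) by (simp add: C_def)
    qed
    finally show ?thesis by simp
  qed
  have "\<forall>i\<in>P. (\<Sum>j\<in>P. C i j * A l j) = 0" if "l < k" for l
    using that
  proof (induction l rule: less_induct)
    case (less l)
    define b where "b i = (if i \<in> P then \<Sum>j\<in>P. C i j * A l j else 0)" for i
    have "\<forall>i. b i = 0"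
    proof (rule nonsing[THEN spec, THEN mp, THEN spec, THEN mp, THEN mp, of l])
      show "\<forall>m<l. (\<Sum>i\<in>P. A m i * b i) = 0"
      proof (intro allI impI)
        fix m assume m: "m < l"
        \<comment> \<open>Symmetry of \<open>C\<close> moves it from vector \<open>l\<close> to
          vector \<open>m\<close>, which it kills by induction.\<close>
        have "(\<Sum>i\<in>P. A m i * b i) = (\<Sum>i\<in>P. \<Sum>j\<in>P. A m i * (C i j * A l j))"
          by (simp add: b_def sum_distrib_left)
        also have "\<dots> = (\<Sum>j\<in>P. \<Sum>i\<in>P. A m i * (C i j * A l j))" by (rule sum.swap)
        also have "\<dots> = (\<Sum>j\<in>P. A l j * (\<Sum>i\<in>P. C j i * A m i))"
          unfolding sum_distrib_left using C_sym by (intro sum.cong refl) (simp add: mult_ac)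
        also have "\<dots> = 0" using less.IH[OF m] less.prems m by simp
        finally show "(\<Sum>i\<in>P. A m i * b i) = 0" .
      qed
      show "\<forall>i. i \<notin> p ` {..<l} \<longrightarrow> b i = 0" using eqC[OF less.prems] by (simp add: b_def)
    qed (use less.prems in simp)
    then show ?case unfolding b_def by meson
  qed
  then show ?thesis using x unfolding C_def by blast
qed

section \<open>Counting the edges of the union\<close>

lemma segments_on_subset_hulls:
  "segments_on P \<subseteq> (\<lambda>X. convex hull X) ` {X. X \<subseteq> P \<and> card X = 2}"
proof
  fix e assume "e \<in> segments_on P"
  then obtain a b where "a \<in> P" "b \<in> P" "a \<noteq> b" "e = convex hull {a, b}"
    by (auto simp: segments_on_def segment_convex_hull)
  then show "e \<in> (\<lambda>X. convex hull X) ` {X. X \<subseteq> P \<and> card X = 2}"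
    by (intro image_eqI[of _ _ "{a, b}"]) auto
qed

lemma finite_segments_on: "finite P \<Longrightarrow> finite (segments_on P)"
  by (rule finite_subset[OF segments_on_subset_hulls]) simp

lemma card_segments_on_le:
  assumes "finite P"
  shows "card (segments_on P) \<le> card P choose 2"
  using surj_card_le[OF _ segments_on_subset_hulls, of P] assms by (simp add: n_subsets)

lemma card_union_thrackles_le:
  assumes P: "strictly_convex_position P" "finite P" and n: "card P = n" "3 \<le> n" and "k \<le> n"
    and T: "\<And>l. l < k \<Longrightarrow> convex_thrackle P (T l)"
  shows "card (\<Union>l<k. T l) \<le> (\<Sum>l<k. n - l)"
proof (rule ccontr)
  define U where "U = (\<Union>l<k. T l)"
  assume "\<not> card (\<Union>l<k. T l) \<le> (\<Sum>l<k. n - l)"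
  then have big: "(\<Sum>l<k. n - l) < card U" by (simp add: U_def)
  then have "finite U" using card_ge_0_finite by (metis gr_zeroI not_less_zero)
  \<comment> \<open>Makes the final bound \<open>2 * n * n * \<epsilon> * M\<close> equal to half of
    \<open>M\<close>.\<close>
  define \<epsilon> where "\<epsilon> = 1 / (4 * (real n)\<^sup>2)"
  have "0 < \<epsilon>" using n by (simp add: \<epsilon>_def)
  obtain K where K: "\<And>i j. K i j = K j i" "\<And>i j. i \<noteq> j \<Longrightarrow> 0 < K i j"
    and close: "\<And>T. convex_thrackle P T \<Longrightarrow>
      \<exists>a. \<forall>i\<in>P. \<forall>j\<in>P. \<bar>a i * a j * K i j - incidence T i j\<bar> < \<epsilon>"
    using thrackle_scaling[OF P] n \<open>0 < \<epsilon>\<close> by metis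
  obtain a where a: "\<And>l. l < k \<Longrightarrow> \<forall>i\<in>P. \<forall>j\<in>P. \<bar>a l i * a l j * K i j - incidence (T l) i j\<bar> < \<epsilon>"
    using close[OF T] by metis
  obtain p where "bij_betw p {..<n} P" using ex_bij_betw_nat_finite[OF P(2)] n(1) by (auto simp: atLeast0LessThan)
  then have p: "inj_on p {..<k}" "p ` {..<k} \<subseteq> P"
    using \<open>k \<le> n\<close> by (auto simp: bij_betw_def intro: inj_on_subset)
  have "\<exists>\<delta>>0. \<forall>i\<in>P. \<forall>j\<in>P.
      \<bar>(a l i + \<delta> * of_bool (i = p l)) * (a l j + \<delta> * of_bool (j = p l)) * K i j - incidence (T l) i j\<bar> < \<epsilon>"
    if "l < k" for l
    using small_perturbation[OF P(2) a[OF that]] .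
  then obtain \<delta> where \<delta>: "\<And>l. l < k \<Longrightarrow> 0 < \<delta> l \<and> (\<forall>i\<in>P. \<forall>j\<in>P.
      \<bar>(a l i + \<delta> l * of_bool (i = p l)) * (a l j + \<delta> l * of_bool (j = p l)) * K i j - incidence (T l) i j\<bar> < \<epsilon>)"
    by metis
  have "\<delta> l \<noteq> 0" if "l < k" for l using \<delta>[OF that] by simp
  from nonsingular_perturbation[of P p k \<delta> a, OF P(2) p this]
  obtain s where s: "\<And>l. s l = 0 \<or> s l = \<delta> l"
    and nonsing: "\<forall>l\<le>k. \<forall>b. (\<forall>m<l. (\<Sum>i\<in>P. (a m i + s m * of_bool (i = p m)) * b i) = 0) \<longrightarrow>
      (\<forall>i. i \<notin> p ` {..<l} \<longrightarrow> b i = 0) \<longrightarrow> (\<forall>i. b i = 0)"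
    by blast
  define A where "A l i = a l i + s l * of_bool (i = p l)" for l i
  have A: "\<bar>A l i * A l j * K i j - incidence (T l) i j\<bar> < \<epsilon>" if "l < k" "i \<in> P" "j \<in> P" for l i j
  proof (cases "s l = 0")
    case True
    then show ?thesis using a that by (simp add: A_def)
  next
    case False
    then show ?thesis using s[of l] \<delta>[OF that(1)] that(2,3) unfolding A_def by presburger
  qed
  from symmetric_kernel_exists[of P n U k p A, OF P(2) n(1) \<open>finite U\<close> big p nonsing[folded A_def]]
  obtain x where x: "\<exists>e\<in>U. x e \<noteq> 0" and ker: "\<forall>l<k. \<forall>i\<in>P.
      (\<Sum>j\<in>P. (if i \<noteq> j \<and> closed_segment i j \<in> U then x (closed_segment i j) else 0) * A l j) = 0"
    by (elim exE conjE)
  \<comment> \<open>The kernel matrix divided entrywise by \<open>K\<close>, so that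
    \<open>K i j * C i j\<close> gives it back.\<close>
  define C where "C i j = (if i \<noteq> j \<and> closed_segment i j \<in> U then x (closed_segment i j) else 0) / K i j" for i j
  have C_sym: "C i j = C j i" for i j using K(1)[of i j] by (auto simp: C_def closed_segment_commute)
  define M where "M = Max ((\<lambda>(i, j). \<bar>C i j\<bar>) ` (P \<times> P))"
  have "P \<noteq> {}" using n by auto
  then have "M \<in> (\<lambda>(i, j). \<bar>C i j\<bar>) ` (P \<times> P)"
    unfolding M_def using P(2) by (intro Max_in) auto
  then obtain u v where uv: "u \<in> P" "v \<in> P" "\<bar>C u v\<bar> = M" by auto
  have M: "\<bar>C i j\<bar> \<le> M" if "i \<in> P" "j \<in> P" for i j
    unfolding M_def using P(2) that by (intro Max_ge) auto
  obtain e where e: "e \<in> U" "x e \<noteq> 0" using x by blast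
  then have "e \<in> segments_on P"
    using T by (auto simp: U_def convex_thrackle_def geometric_graph_def)
  then obtain i j where ij: "i \<in> P" "j \<in> P" "i \<noteq> j" "e = closed_segment i j"
    by (auto simp: segments_on_def)
  have "C i j \<noteq> 0" using ij e K(2)[OF ij(3)] by (simp add: C_def)
  then have "0 < M" using M[OF ij(1,2)] by linarith
  then have "C u v \<noteq> 0" using uv by auto
  then have uv': "u \<noteq> v" "closed_segment u v \<in> U" by (auto simp: C_def split: if_splits)
  then obtain l where l: "l < k" "closed_segment u v \<in> T l" by (auto simp: U_def)
  \<comment> \<open>With the scaled matrix in place of \<open>incidence (T l)\<close> the sum is
    zero by \<open>ker\<close>; the replacement costs at most \<open>\<epsilon> * M\<close> per
    entry.\<close>
  have "\<bar>\<Sum>j\<in>P. incidence (T l) i j * C i j\<bar> \<le> n * (\<epsilon> * M)" if i: "i \<in> P" for i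
  proof -
    have "(\<Sum>j\<in>P. A l i * A l j * K i j * C i j) = A l i * (\<Sum>j\<in>P.
        (if i \<noteq> j \<and> closed_segment i j \<in> U then x (closed_segment i j) else 0) * A l j)"
      unfolding sum_distrib_left
    proof (intro sum.cong refl)
      fix j
      show "A l i * A l j * K i j * C i j = A l i *
        ((if i \<noteq> j \<and> closed_segment i j \<in> U then x (closed_segment i j) else 0) * A l j)"
        using K(2)[of i j] by (cases "i = j") (auto simp: C_def)
    qed
    also have "\<dots> = 0" using ker[rule_format, OF l(1) i] by simp
    finally have "(\<Sum>j\<in>P. incidence (T l) i j * C i j)
        = (\<Sum>j\<in>P. (incidence (T l) i j - A l i * A l j * K i j) * C i j)"
      by (simp add: left_diff_distrib sum_subtractf)
    also have "\<bar>\<dots>\<bar> \<le> (\<Sum>j\<in>P. \<bar>(incidence (T l) i j - A l i * A l j * K i j) * C i j\<bar>)"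
      by (rule sum_abs)
    also have "\<dots> \<le> (\<Sum>j\<in>P. \<epsilon> * M)"
      unfolding abs_mult using A[OF l(1) i] M[OF i] \<open>0 < \<epsilon>\<close>
      by (intro sum_mono mult_mono) (auto simp: abs_minus_commute less_imp_le)
    finally show ?thesis using n by simp
  qed
  moreover have "general_position P"
    using P by (simp add: strictly_convex_position_def general_position_def)
  ultimately have "\<bar>C u v\<bar> \<le> 2 * (card P * (n * (\<epsilon> * M)))"
    using thrackle_entry_le[OF _ P(2) T[OF l(1)], of C] C_sym uv uv' l by blast
  also have "\<dots> = M / 2" using n by (simp add: \<epsilon>_def power2_eq_square field_simps)
  finally show False using uv \<open>0 < M\<close> by simp
qed

lemma sum_diff_lessThan:
  assumes "k \<le> n"
  shows "int (\<Sum>l<k. n - l) = int k * int n - int (k choose 2)"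
  using assms
proof (induction k)
  case (Suc k)
  have "Suc k choose 2 = k + (k choose 2)" by (simp add: numeral_2_eq_2)
  then show ?case using Suc by (simp add: of_nat_diff algebra_simps)
qed simp

lemma of_nat_choose_2: "2 * real (m choose 2) = real m * (real m - 1)"
  by (induction m) (simp_all add: numeral_2_eq_2 algebra_simps)

theorem theorem4:
  fixes P :: "(real^2) set" and n k :: nat and T :: "nat \<Rightarrow> (real^2) set set"
  assumes "n \<ge> 3"
    and "card P = n"
    and "strictly_convex_position P"
    and "\<And>i. i \<in> {1..k} \<Longrightarrow> maximal_convex_thrackle P (T i)"
    and "real k \<le> real n + 1 / 2 + sqrt (2 * real n + 1 / 4)"
  shows "int (card (\<Union>i\<in>{1..k}. T i)) \<le> int k * int n - int (k choose 2)"
proof -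
  have fin: "finite P" using assms(1,2) by (intro card_ge_0_finite) simp
  have T: "convex_thrackle P (T i)" if "i \<in> {1..k}" for i
    using assms(4)[OF that] by (simp add: maximal_convex_thrackle_def)
  show ?thesis
  proof (cases "k \<le> n")
    case True
    have "{1..k} = Suc ` {..<k}" by (simp add: image_Suc_lessThan)
    then have "(\<Union>i\<in>{1..k}. T i) = (\<Union>l<k. T (Suc l))" by simp
    then have "card (\<Union>i\<in>{1..k}. T i) \<le> (\<Sum>l<k. n - l)"
      using card_union_thrackles_le[OF assms(3) fin assms(2,1) True, of "\<lambda>l. T (Suc l)"] T by simp
    then show ?thesis using sum_diff_lessThan[OF True] by linarith
  next
    case False
    have "(\<Union>i\<in>{1..k}. T i) \<subseteq> segments_on P"
      using T unfolding convex_thrackle_def geometric_graph_def by blast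
    then have "card (\<Union>i\<in>{1..k}. T i) \<le> n choose 2"
      using card_mono[OF finite_segments_on[OF fin]] card_segments_on_le[OF fin] assms(2) by (metis le_trans)
    moreover have "real (n choose 2) \<le> real k * real n - real (k choose 2)"
    proof -
      \<comment> \<open>The assumed bound on \<open>k\<close> is the larger root of the quadratic
        inequality \<open>n choose 2 \<le> k * n - (k choose 2)\<close> in \<open>k\<close>;
        squaring recovers that inequality.\<close>
      have "real k - real n - 1 / 2 \<le> sqrt (2 * real n + 1 / 4)" "0 \<le> real k - real n - 1 / 2"
        using assms(5) False by linarith+
      then have "(real k - real n - 1 / 2)\<^sup>2 \<le> 2 * real n + 1 / 4"
        by (intro sqrt_ge_absD) simp
      then show ?thesis
        using of_nat_choose_2[of n] of_nat_choose_2[of k] by (simp add: power2_eq_square algebra_simps)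
    qed
    then have "int (n choose 2) \<le> int k * int n - int (k choose 2)"
      by (simp add: of_nat_diff flip: of_int_le_iff[where ?'a = real])
    ultimately show ?thesis by linarith
  qed
qed

end
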